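(* As formal power series in $q$, \[ \frac{(1,0,63,q)-(7,0,9,q)}{2}=q\,E(-q^3)\,E(-q^{21}). \]
   Context: For a binary quadratic form $(a,b,c)$, i.e. $ax^2+bxy+cy^2$, its theta series is $(a,b,c,q):=\sum_{x,y\in\mathbb{Z}}q^{ax^2+bxy+cy^2}$. Here $E(q):=\prod_{n=1}^{\infty}(1-q^n)$, so $E(-q^k)=\prod_{n=1}^{\infty}(1-(-q^k)^n)$. *)

theory Defs
  imports "HOL-Analysis.Analysis" "HOL-Computational_Algebra.Formal_Power_Series"
begin

text \<open>
  Infinite sums and products of formal power series are taken in the library's \<open>q\<close>-adic
  (coefficientwise) topology on \<^typ>\<open>'a fps\<close>. The truncation \<^const>\<open>nat\<close> in the exponent is
  harmless for positive definite forms, whose values are nonnegative.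
\<close>

definition qf_theta :: "int \<Rightarrow> int \<Rightarrow> int \<Rightarrow> 'a::comm_ring_1 fps \<Rightarrow> 'a fps" where
  "qf_theta a b c q = (\<Sum>\<^sub>\<infinity>(x::int, y::int)\<in>UNIV. q ^ nat (a * x\<^sup>2 + b * x * y + c * y\<^sup>2))"

definition euler_E :: "'a::comm_ring_1 fps \<Rightarrow> 'a fps" where
  "euler_E q = (\<Prod>n. 1 - q ^ Suc n)"

text \<open>
  The library values of a divergent sum or product are arbitrary, so we record that the sum and
  the product above do converge.
\<close>

lemma finite_qf_le:
  fixes a b c :: int
  assumes "a > 0" "b\<^sup>2 < 4 * a * c"
  shows "finite {(x::int, y::int). a * x\<^sup>2 + b * x * y + c * y\<^sup>2 \<le> N}"
proof -
  have "c > 0"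
  proof (rule ccontr)
    assume "\<not> c > 0"
    then have "4 * a * c \<le> 0" using assms(1) by (simp add: mult_le_0_iff)
    then show False using assms(2) zero_le_power2[of b] by linarith
  qed
  have bnd: "\<bar>z\<bar> \<le> M" if "z\<^sup>2 \<le> M" for z M :: int
  proof -
    have "\<bar>z\<bar> \<le> \<bar>z\<bar>\<^sup>2"
    proof (cases "z = 0")
      case False
      then have "\<bar>z\<bar> * 1 \<le> \<bar>z\<bar> * \<bar>z\<bar>" by (intro mult_left_mono) auto
      then show ?thesis unfolding power2_eq_square by simp
    qed simp
    then show ?thesis using that by simp
  qed
  have "{(x::int, y::int). a * x\<^sup>2 + b * x * y + c * y\<^sup>2 \<le> N}
        \<subseteq> {-\<bar>4 * c * N\<bar>..\<bar>4 * c * N\<bar>} \<times> {-\<bar>4 * a * N\<bar>..\<bar>4 * a * N\<bar>}"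
  proof clarify
    fix x y :: int
    assume le: "a * x\<^sup>2 + b * x * y + c * y\<^sup>2 \<le> N"
    have D: "1 \<le> 4 * a * c - b\<^sup>2" using assms(2) by linarith
    have "4 * a * (a * x\<^sup>2 + b * x * y + c * y\<^sup>2) = (2 * a * x + b * y)\<^sup>2 + (4 * a * c - b\<^sup>2) * y\<^sup>2"
      by (simp add: power2_eq_square algebra_simps)
    moreover have "4 * a * (a * x\<^sup>2 + b * x * y + c * y\<^sup>2) \<le> 4 * a * N"
      using le assms(1) by simp
    moreover have "1 * y\<^sup>2 \<le> (4 * a * c - b\<^sup>2) * y\<^sup>2"
      using D by (intro mult_right_mono) auto
    ultimately have "y\<^sup>2 \<le> 4 * a * N" using zero_le_power2[of "2 * a * x + b * y"] by linarith
    then have y: "\<bar>y\<bar> \<le> 4 * a * N" by (rule bnd)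
    have "4 * c * (a * x\<^sup>2 + b * x * y + c * y\<^sup>2) = (2 * c * y + b * x)\<^sup>2 + (4 * a * c - b\<^sup>2) * x\<^sup>2"
      by (simp add: power2_eq_square algebra_simps)
    moreover have "4 * c * (a * x\<^sup>2 + b * x * y + c * y\<^sup>2) \<le> 4 * c * N"
      using le \<open>c > 0\<close> by simp
    moreover have "1 * x\<^sup>2 \<le> (4 * a * c - b\<^sup>2) * x\<^sup>2"
      using D by (intro mult_right_mono) auto
    ultimately have "x\<^sup>2 \<le> 4 * c * N" using zero_le_power2[of "2 * c * y + b * x"] by linarith
    then have x: "\<bar>x\<bar> \<le> 4 * c * N" by (rule bnd)
    show "x \<in> {-\<bar>4 * c * N\<bar>..\<bar>4 * c * N\<bar>} \<and> y \<in> {-\<bar>4 * a * N\<bar>..\<bar>4 * a * N\<bar>}"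
      using x y by auto
  qed
  then show ?thesis by (rule finite_subset) auto
qed

lemma qf_theta_summable:
  fixes a b c :: int
  assumes "a > 0" "b\<^sup>2 < 4 * a * c"
  shows "(\<lambda>(x::int, y::int). (fps_X :: 'a::comm_ring_1 fps) ^ nat (a * x\<^sup>2 + b * x * y + c * y\<^sup>2))
         summable_on UNIV"
proof -
  define Q where "Q = (\<lambda>(x::int, y::int). a * x\<^sup>2 + b * x * y + c * y\<^sup>2)"
  have fin: "finite {p. nat (Q p) \<le> n}" for n
    using finite_qf_le[OF assms, of "int n"] by (simp add: Q_def case_prod_unfold nat_le_iff)
  define S :: "'a fps" where "S = Abs_fps (\<lambda>n. \<Sum>p\<in>{p. nat (Q p) \<le> n}. fps_nth (fps_X ^ nat (Q p)) n)"
  have "((\<lambda>p. (fps_X :: 'a fps) ^ nat (Q p)) has_sum S) UNIV"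
    unfolding has_sum_def
  proof (rule tendsto_fpsI)
    fix n
    have "\<forall>\<^sub>F A in finite_subsets_at_top UNIV. finite A \<and> {p. nat (Q p) \<le> n} \<subseteq> A"
      using fin[of n] by (auto simp: eventually_finite_subsets_at_top)
    then show "\<forall>\<^sub>F A in finite_subsets_at_top UNIV.
        fps_nth (\<Sum>p\<in>A. (fps_X :: 'a fps) ^ nat (Q p)) n = fps_nth S n"
    proof eventually_elim
      case (elim A)
      then show ?case
        unfolding S_def fps_sum_nth fps_nth_Abs_fps
        using fin[of n] by (intro sum.mono_neutral_right) (auto simp add: fps_X_power_nth)
    qed
  qed
  then show ?thesis
    unfolding summable_on_def by (auto simp: Q_def case_prod_unfold)
qed

lemma euler_E_convergent:
  fixes q :: "'a::idom fps"
  assumes "fps_nth q 0 = 0"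
  shows "convergent_prod (\<lambda>n. 1 - q ^ Suc n)"
proof -
  define P where "P = (\<lambda>n. \<Prod>i\<le>n. 1 - q ^ Suc i)"
  define L where "L = Abs_fps (\<lambda>n. fps_nth (P n) n)"
  have step: "fps_nth (P (Suc m)) n = fps_nth (P m) n" if "n \<le> m" for m n
  proof -
    have "fps_nth (P m * q ^ Suc (Suc m)) n = 0"
      unfolding fps_mult_nth
    proof (intro sum.neutral ballI)
      fix i
      have "fps_nth (q ^ Suc (Suc m)) (n - i) = 0"
        using that startsby_zero_power_prefix[OF assms, of "Suc (Suc m)"] by (simp del: power_Suc)
      then show "fps_nth (P m) i * fps_nth (q ^ Suc (Suc m)) (n - i) = 0"
        by (simp only: mult_zero_right)
    qed
    then show ?thesis by (simp add: P_def right_diff_distrib del: power_Suc)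
  qed
  have stable: "fps_nth (P m) n = fps_nth (P n) n" if "n \<le> m" for m n
    using that by (induction rule: dec_induct) (auto simp: step)
  have "P \<longlonglongrightarrow> L"
  proof (rule tendsto_fpsI)
    fix n show "\<forall>\<^sub>F m in sequentially. fps_nth (P m) n = fps_nth L n"
      using eventually_ge_at_top[of n] 
      by eventually_elim (unfold L_def fps_nth_Abs_fps, rule stable)
  qed
  moreover have "fps_nth L 0 \<noteq> 0" by (simp add: L_def P_def assms)
  then have "L \<noteq> 0" by auto
  ultimately show ?thesis
    by (auto simp: convergent_prod_def raw_has_prod_def P_def intro!: exI[of _ 0] exI[of _ L])
qed

end

theory Submission
  imports Defs
begin

text \<open>
  Let \<open>c(x,y) = [3|y] - [3|x]\<close>, so that the difference of the two theta series is
  \<open>\<Sum> c(x,y) q\<^bsup>x\<^sup>2+7y\<^sup>2\<^esup>\<close>. By the pentagonal number theorem the right-hand side is the sum of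
  \<open>(-2/uv) q\<^bsup>(u\<^sup>2+7v\<^sup>2)/8\<^esup>\<close> over \<open>u \<equiv> v \<equiv> 1 (mod 6)\<close>; flipping signs of \<open>u\<close> and \<open>v\<close>, twice this
  is the sum of \<open>(uv/3) q\<^bsup>(u\<^sup>2+7v\<^sup>2)/8\<^esup>\<close> over odd \<open>u \<equiv> v (mod 8)\<close> minus the same sum over odd
  \<open>v \<equiv> 5u (mod 8)\<close>. Multiplication of \<open>x + y\<surd>-7\<close> by \<open>\<omega> = (1 + \<surd>-7)/2\<close> identifies the first sum
  with the terms of the theta difference having \<open>x + y\<close> odd. The second sum and the terms with
  \<open>x + y\<close> even together form the sum of \<open>c(z) q\<^bsup>N(z)\<^esup>\<close> over the multiples \<open>z\<close> of \<open>\<omega>\<close> in the ring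
  of integers of \<open>\<rat>(\<surd>-7)\<close>, which vanishes because \<open>c(\<omega>w) = -c(\<omega> cnj(w))\<close>.
\<close>

section \<open>The pentagonal number theorem\<close>

definition pent :: "int \<Rightarrow> nat" where
  "pent j = nat (j * (3 * j + 1) div 2)"

lemma int_pent: "2 * int (pent j) = j * (3 * j + 1)"
proof -
  have "even (j * (3 * j + 1))" by auto
  moreover have "j * (3 * j + 1) \<ge> 0"
    by (cases "j \<ge> 0") (auto intro: mult_nonneg_nonneg mult_nonpos_nonpos)
  ultimately show ?thesis by (simp add: pent_def)
qed

text \<open>Bounds the index by the exponent, so that only finitely many indices contribute to a
  given coefficient.\<close>

lemma abs_le_pent: "\<bar>j\<bar> \<le> int (pent j)"
proof -
  have "\<bar>j\<bar> \<le> \<bar>j\<bar> * \<bar>j\<bar>"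
    using mult_right_mono[of 1 "\<bar>j\<bar>" "\<bar>j\<bar>"] by (cases "j = 0") auto
  then have "\<bar>j\<bar> \<le> j\<^sup>2" by (simp add: power2_eq_square)
  then show ?thesis using int_pent[of j] by (simp add: power2_eq_square algebra_simps)
qed

text \<open>Completing the square makes a pentagonal exponent the square of a number congruent to 1
  mod 6; as \<open>j\<close> runs over all integers, every such number occurs.\<close>

lemma pent_square: "24 * int (pent j) + 1 = (6 * j + 1)\<^sup>2"
  using int_pent[of j] by (simp add: power2_eq_square algebra_simps)

text \<open>
  Shanks' finite form of the pentagonal number theorem. Modulo \<open>q\<^bsup>n+1\<^esup>\<close> only the term \<open>s = 0\<close>,
  the partial Euler product, survives.
\<close>

definition shanks_term :: "'a::comm_ring_1 \<Rightarrow> nat \<Rightarrow> nat \<Rightarrow> 'a" where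
  "shanks_term q n s = (-1) ^ s * (\<Prod>i\<in>{s<..n}. 1 - q ^ i) * q ^ (s * n + s * (s + 1) div 2)"

text \<open>After telescoping only \<open>- H n\<close> and the new last term remain; they are the
  pentagonal terms of index \<open>- int (Suc n)\<close> and \<open>int (Suc n)\<close>.\<close>

lemma sum_shanks_term_Suc:
  fixes q :: "'a::comm_ring_1"
  shows "(\<Sum>s\<le>Suc n. shanks_term q (Suc n) s) = (\<Sum>s\<le>n. shanks_term q n s)
     + (-1) ^ Suc n * (q ^ pent (- int (Suc n)) + q ^ pent (int (Suc n)))"
proof -
  \<comment> \<open>\<open>H s\<close> is what the partial sum up to \<open>s\<close> loses when
    \<open>n\<close> becomes \<open>Suc n\<close>; it equals
    \<open>shanks_term q n s * q ^ (s + Suc n)\<close>.\<close>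
  define H where "H s = (-1) ^ s * (\<Prod>i\<in>{s<..n}. 1 - q ^ i) * q ^ (s * Suc n + Suc n + s * (s + 1) div 2)" for s
  have tri: "Suc s * (Suc s + 1) div 2 = s * (s + 1) div 2 + Suc s" for s by simp
  have split: "(\<Prod>i\<in>{s<..Suc n}. 1 - q ^ i) = (\<Prod>i\<in>{s<..n}. 1 - q ^ i) * (1 - q ^ Suc n)" if "s \<le> n" for s
  proof -
    have "{s<..Suc n} = insert (Suc n) {s<..n}" using that by auto
    then show ?thesis by (simp add: mult.commute)
  qed
  \<comment> \<open>Splitting off \<open>1 - q\<^bsup>n+1\<^esup>\<close> and writing \<open>q\<^sup>s = 1 - (1 - q\<^sup>s)\<close> makes the sum telescope.\<close>
  have "(\<Sum>s\<le>m. shanks_term q (Suc n) s) = (\<Sum>s\<le>m. shanks_term q n s) - H m" if "m \<le> n" for m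
    using that
  proof (induction m)
    case 0
    then show ?case using split[of 0] by (simp add: shanks_term_def H_def algebra_simps)
  next
    case (Suc m)
    have ins: "{m<..n} = insert (Suc m) {Suc m<..n}" using Suc.prems by auto
    \<comment> \<open>\<open>P\<close> and \<open>E\<close> are the product and the exponent of the
      old term at \<open>Suc m\<close>; the other three quantities are expressed through
      them.\<close>
    define P where "P = (\<Prod>i\<in>{Suc m<..n}. 1 - q ^ i)"
    define E where "E = Suc m * n + Suc m * (Suc m + 1) div 2"
    have E1: "Suc m * Suc n + Suc m * (Suc m + 1) div 2 = E + Suc m" unfolding E_def by simp
    have E2: "Suc m * Suc n + Suc n + Suc m * (Suc m + 1) div 2 = E + Suc m + Suc n" unfolding E_def by simp
    have E3: "m * Suc n + Suc n + m * (m + 1) div 2 = E" unfolding E_def tri by simp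
    have a: "shanks_term q (Suc n) (Suc m) = (-1) ^ Suc m * (P * (1 - q ^ Suc n)) * q ^ (E + Suc m)"
      unfolding shanks_term_def split[OF Suc.prems] E1 P_def ..
    have b: "shanks_term q n (Suc m) = (-1) ^ Suc m * P * q ^ E"
      unfolding shanks_term_def E_def P_def ..
    have c: "H m = (-1) ^ m * ((1 - q ^ Suc m) * P) * q ^ E"
      unfolding H_def E3 ins P_def by simp
    have d: "H (Suc m) = (-1) ^ Suc m * P * q ^ (E + Suc m + Suc n)"
      unfolding H_def E2 P_def ..
    have "shanks_term q (Suc n) (Suc m) = shanks_term q n (Suc m) + H m - H (Suc m)"
      unfolding a b c d power_add power_Suc[of "-1"] by (simp add: algebra_simps)
    then show ?case using Suc by simp
  qed
  from this[of n] have "(\<Sum>s\<le>Suc n. shanks_term q (Suc n) s)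
      = (\<Sum>s\<le>n. shanks_term q n s) - H n + shanks_term q (Suc n) (Suc n)" by simp
  moreover have "pent (- int (Suc n)) = n * Suc n + Suc n + n * (n + 1) div 2"
  proof -
    have "even (n * (n + 1))" by simp
    then have "2 * int (n * (n + 1) div 2) = int n * (int n + 1)"
      by (metis dvd_mult_div_cancel of_nat_1 of_nat_add of_nat_mult of_nat_numeral)
    then have "2 * int (pent (- int (Suc n))) = 2 * int (n * Suc n + Suc n + n * (n + 1) div 2)"
      unfolding int_pent by (simp add: algebra_simps)
    then show ?thesis by (simp only: mult_cancel_left of_nat_eq_iff) simp
  qed
  moreover have "pent (int (Suc n)) = Suc n * Suc n + Suc n * (Suc n + 1) div 2"
  proof -
    have "even (Suc n * (Suc n + 1))" by simp
    then have "2 * int (Suc n * (Suc n + 1) div 2) = int (Suc n) * (int (Suc n) + 1)"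
      by (metis dvd_mult_div_cancel of_nat_1 of_nat_add of_nat_mult of_nat_numeral)
    then have "2 * int (pent (int (Suc n))) = 2 * int (Suc n * Suc n + Suc n * (Suc n + 1) div 2)"
      unfolding int_pent by (simp add: algebra_simps)
    then show ?thesis by (simp only: mult_cancel_left of_nat_eq_iff) simp
  qed
  ultimately show ?thesis by (simp add: H_def shanks_term_def algebra_simps)
qed

lemma shanks_identity:
  fixes q :: "'a::comm_ring_1"
  shows "(\<Sum>s\<le>n. shanks_term q n s) = (\<Sum>j\<in>{- int n..int n}. (-1) ^ nat \<bar>j\<bar> * q ^ pent j)"
proof (induction n)
  case 0
  then show ?case by (simp add: shanks_term_def pent_def)
next
  case (Suc n)
  have eq: "{- int (Suc n)..int (Suc n)}
      = insert (int (Suc n)) (insert (- int (Suc n)) {- int n..int n})" by auto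
  have "nat \<bar>- int (Suc n)\<bar> = Suc n" "nat \<bar>int (Suc n)\<bar> = Suc n" by linarith+
  then show ?case unfolding sum_shanks_term_Suc Suc.IH eq
    by (subst sum.insert, simp, simp, subst sum.insert, simp, simp, simp only: ring_distribs ac_simps)
qed

text \<open>The window size \<open>m\<close> is independent of \<open>n\<close>, so that one finite
  sum serves all coefficients up to \<open>m\<close>.\<close>

lemma euler_E_nth:
  fixes q :: "'a::idom fps"
  assumes q: "fps_nth q 0 = 0" and "n \<le> m"
  shows "fps_nth (euler_E q) n = fps_nth (\<Sum>j\<in>{- int m..int m}. (-1) ^ nat \<bar>j\<bar> * q ^ pent j) n"
proof -
  have low: "fps_nth (f * q ^ k) l = 0" if "l < k" for f k l
    unfolding fps_mult_nth using that startsby_zero_power_prefix[OF q, of k] 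
    by (intro sum.neutral ballI) simp
  have part: "fps_nth (\<Sum>j\<in>{- int m..int m}. (-1) ^ nat \<bar>j\<bar> * q ^ pent j) n
      = fps_nth (\<Prod>i<m. 1 - q ^ Suc i) n" if "n \<le> m" for m
  proof -
    \<comment> \<open>For \<open>s > 0\<close> the exponent of \<open>q\<close> is at least
      \<open>m + 1\<close>, hence exceeds \<open>n\<close>.\<close>
    have "fps_nth (shanks_term q m s) n = 0" if "s \<in> {..m} - {0}" for s
      unfolding shanks_term_def
    proof (rule low)
      have "0 < s" using that by auto
      then have "m \<le> s * m" "1 \<le> s * (s + 1) div 2" by (cases s; simp)+
      then show "n < s * m + s * (s + 1) div 2" using \<open>n \<le> m\<close> by linarith
    qed
    then have "fps_nth (\<Sum>s\<le>m. shanks_term q m s) n = fps_nth (shanks_term q m 0) n"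
      unfolding fps_sum_nth by (subst sum.remove[of _ 0]) auto
    moreover have "(\<Prod>i\<in>{0<..m}. 1 - q ^ i) = (\<Prod>i<m. 1 - q ^ Suc i)"
      by (rule prod.reindex_bij_witness[of _ Suc "\<lambda>i. i - 1"]) auto
    ultimately show ?thesis unfolding shanks_identity by (simp add: shanks_term_def del: power_Suc)
  qed
  have stable: "fps_nth (\<Prod>i<k. 1 - q ^ Suc i) l = fps_nth (\<Prod>i<l. 1 - q ^ Suc i) l"
    if "l \<le> k" for k l
    using that
  proof (induction k rule: dec_induct)
    case (step k)
    then show ?case using low[of l "Suc k" "\<Prod>i<k. 1 - q ^ Suc i"]
      by (simp add: right_diff_distrib del: power_Suc)
  qed simp
  define L where "L = Abs_fps (\<lambda>l. fps_nth (\<Prod>i<l. 1 - q ^ Suc i) l)"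
  have "(\<lambda>k. \<Prod>i<k. 1 - q ^ Suc i) \<longlonglongrightarrow> L"
  proof (rule tendsto_fpsI)
    fix l show "\<forall>\<^sub>F k in sequentially. fps_nth (\<Prod>i<k. 1 - q ^ Suc i) l = fps_nth L l"
      using eventually_ge_at_top[of l]
      by eventually_elim (unfold L_def fps_nth_Abs_fps, rule stable)
  qed
  \<comment> \<open>\<open>raw_has_prod\<close> demands a nonzero limit; the constant coefficient 1
    provides it.\<close>
  moreover have "fps_nth L 0 = 1" by (simp add: L_def)
  then have "L \<noteq> 0" by auto
  ultimately have "(\<lambda>n. 1 - q ^ Suc n) has_prod L"
    by (simp add: has_prod_def raw_has_prod_def LIMSEQ_lessThan_iff_atMost del: power_Suc)
  then have "euler_E q = L" unfolding euler_E_def by (rule has_prod_unique[symmetric])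
  then have "fps_nth (euler_E q) n = fps_nth (\<Prod>i<n. 1 - q ^ Suc i) n"
    by (simp add: L_def)
  then show ?thesis using part stable[of n m] \<open>n \<le> m\<close> by simp
qed

section \<open>Character sums over the solutions of \<open>x^2 + 7 * y^2 = n\<close>\<close>

definition dvd3_diff :: "int \<times> int \<Rightarrow> int" where
  "dvd3_diff = (\<lambda>(x, y). of_bool (3 dvd y) - of_bool (3 dvd x))"

text \<open>The Legendre symbol modulo 3.\<close>

definition kron3 :: "int \<Rightarrow> int" where
  "kron3 u = (if u mod 3 = 0 then 0 else if u mod 3 = 1 then 1 else -1)"

definition norm7 :: "int \<Rightarrow> (int \<times> int) set" where
  "norm7 n = {(x, y). x\<^sup>2 + 7 * y\<^sup>2 = n}"

lemma finite_norm7: "finite (norm7 n)"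
  using finite_qf_le[of 1 0 7 n] by (rule rev_finite_subset) (auto simp: norm7_def)

lemma kron3_mod: "u mod 3 = v mod 3 \<Longrightarrow> kron3 u = kron3 v"
  by (simp add: kron3_def)

lemma kron3_minus: "kron3 (- u) = - kron3 u"
  unfolding kron3_def by presburger

text \<open>Both sides are the symbol of \<open>x^2 - y^2\<close> modulo 3, since squares are 0 or 1
  there.\<close>

lemma dvd3_diff_eq_kron3: "dvd3_diff (x, y) = kron3 (x - y) * kron3 (x + y)"
proof -
  have "x mod 3 \<in> {0, 1, 2}" "y mod 3 \<in> {0, 1, 2}" by auto
  then show ?thesis
    unfolding kron3_def dvd3_diff_def dvd_eq_mod_eq_0
      mod_diff_eq[of x 3 y, symmetric] mod_add_eq[of x 3 y, symmetric] by auto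
qed

text \<open>The substitution is multiplication by \<open>1 + sqrt(-7)\<close>, of norm 8. Modulo 3
  it is \<open>(x - y, x + y)\<close>, so the weights agree; \<open>v - u = 8 * y\<close> gives the
  inverse.\<close>

lemma sum_dvd3_diff_odd:
  "(\<Sum>(x, y) \<in> {(x, y) \<in> norm7 n. odd (x + y)}. dvd3_diff (x, y))
   = (\<Sum>(u, v) \<in> {(u, v) \<in> norm7 (8 * n). odd u \<and> 8 dvd v - u}. kron3 u * kron3 v)"
proof (rule sum.reindex_bij_witness[of _ "\<lambda>(u, v). (v - (v - u) div 8, (v - u) div 8)"
        "\<lambda>(x, y). (x - 7 * y, x + y)"], goal_cases)
  case (1 p) then show ?case by auto
next
  case (2 p)
  then show ?case by (auto simp: norm7_def power2_eq_square algebra_simps)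
next
  case (3 p) then show ?case by (auto simp: algebra_simps)
next
  case (4 p)
  then obtain u v k where p: "p = (u, v)" "u\<^sup>2 + 7 * v\<^sup>2 = 8 * n" "odd u" "v - u = 8 * k"
    by (auto simp: norm7_def elim!: dvdE)
  then have u: "u = v - 8 * k" by simp
  show ?case using p(2,3) unfolding p(1) norm7_def u by (auto simp: power2_eq_square algebra_simps)
next
  case (5 p)
  obtain x y where p: "p = (x, y)" by (cases p)
  have "kron3 (x - 7 * y) = kron3 (x - y)" by (rule kron3_mod) presburger
  then show ?case by (simp add: p dvd3_diff_eq_kron3)
qed

text \<open>In the ring of integers of \<open>\<rat>(\<surd>-7)\<close>, the pairs with \<open>x \<equiv> y (mod 4)\<close> are the multiples
  of \<open>\<omega> = (1 + \<surd>-7) / 2\<close> (as \<open>(x + y\<surd>-7) / 2\<close>), and the involution \<open>t\<close> is \<open>\<omega>w \<mapsto> \<omega> cnj(w)\<close>.\<close>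

lemma sum_dvd3_diff_cong4:
  "(\<Sum>p \<in> {(x, y) \<in> norm7 (4 * n). 4 dvd y - x}. dvd3_diff p) = 0"
proof -
  define S where "S = {(x, y) \<in> norm7 (4 * n). 4 dvd y - x}"
  \<comment> \<open>For \<open>y - x = 4 * b\<close> the element is \<omega>w with w = y - b
    cnj(\<omega>), and \<omega> cnj(w) = (y - b)\<omega> + 2b has coordinates
    \<open>(y + 3 * b, y - b)\<close>.\<close>
  define t where "t = (\<lambda>(x::int, y::int). (y + 3 * ((y - x) div 4), y - (y - x) div 4))"
  have *: "t p \<in> S \<and> t (t p) = p \<and> dvd3_diff (t p) = - dvd3_diff p" if "p \<in> S" for p
  proof -
    obtain x y b where p: "p = (x, y)" "x\<^sup>2 + 7 * y\<^sup>2 = 4 * n" "y - x = 4 * b"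
      using \<open>p \<in> S\<close> by (auto simp: S_def norm7_def elim!: dvdE)
    then have x: "x = y - 4 * b" by simp
    have tp: "t p = (y + 3 * b, y - b)" by (simp add: t_def p(1) x)
    have d: "((y - b) - (y + 3 * b)) div 4 = - b" by presburger
    have ttp: "t (y + 3 * b, y - b) = (x, y)" unfolding t_def prod.case d by (simp add: x)
    have "t p \<in> S" using p(2) unfolding tp S_def norm7_def x
      by (auto simp: power2_eq_square algebra_simps)
    moreover have "dvd3_diff (t p) = - dvd3_diff p"
    proof -
      \<comment> \<open>Modulo 3, \<open>t\<close> exchanges the two coordinates, which negates the
        weight.\<close>
      have "3 dvd y + 3 * b \<longleftrightarrow> 3 dvd y" "3 dvd y - b \<longleftrightarrow> 3 dvd x" unfolding x by presburger+
      then show ?thesis unfolding tp unfolding p(1) by (simp add: dvd3_diff_def)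
    qed
    ultimately show ?thesis using tp ttp p(1) by simp
  qed
  have "sum dvd3_diff S = (\<Sum>p\<in>S. - dvd3_diff p)"
    by (rule sum.reindex_bij_witness[of _ t t]) (use * in auto)
  then show ?thesis by (simp add: S_def sum_negf)
qed

text \<open>Split the vanishing sum over \<open>S\<close> by the parity of \<open>x\<close>: the
  even part is the left-hand side with coordinates doubled, the odd part is the sum on the
  right.\<close>

lemma sum_dvd3_diff_even:
  "(\<Sum>(x, y) \<in> {(x, y) \<in> norm7 n. even (x + y)}. dvd3_diff (x, y))
   = - (\<Sum>(u, v) \<in> {(u, v) \<in> norm7 (8 * n). odd u \<and> 8 dvd v - 5 * u}. kron3 u * kron3 v)"
proof -
  define S where "S = {(x, y) \<in> norm7 (4 * n). 4 dvd y - x}"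
  have fin: "finite S" unfolding S_def using finite_norm7 by (rule finite_subset[rotated]) auto
  have even: "(\<Sum>(x, y) \<in> {(x, y) \<in> norm7 n. even (x + y)}. dvd3_diff (x, y))
      = (\<Sum>p \<in> {p \<in> S. even (fst p)}. dvd3_diff p)"
  proof (rule sum.reindex_bij_witness[of _ "\<lambda>(x, y). (x div 2, y div 2)" "\<lambda>(x, y). (2 * x, 2 * y)"], goal_cases)
    case (1 p) then show ?case by auto
  next
    case (2 p)
    then obtain x y where p: "p = (x, y)" "x\<^sup>2 + 7 * y\<^sup>2 = n" "even (x + y)" by (auto simp: norm7_def)
    then have "4 dvd 2 * y - 2 * x" by presburger
    then show ?case using p by (auto simp: S_def norm7_def power2_eq_square algebra_simps)
  next
    case (3 p)
    then have "even (fst p)" "4 dvd snd p - fst p" by (auto simp: S_def)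
    then have "even (fst p)" "even (snd p)" by presburger+
    then show ?case by (cases p) auto
  next
    case (4 p)
    then obtain x y where p: "p = (x, y)" "x\<^sup>2 + 7 * y\<^sup>2 = 4 * n" "4 dvd y - x" "even x"
      by (auto simp: S_def norm7_def)
    obtain a where a: "x = 2 * a" using p(4) by blast
    have "even y" using p(3,4) by presburger
    then obtain b where b: "y = 2 * b" by blast
    have "even (a + b)" using p(3) unfolding a b by presburger
    then show ?case using p(2) by (auto simp: p(1) a b norm7_def power2_eq_square)
  next
    case (5 p)
    obtain x y where p: "p = (x, y)" by (cases p)
    have "3 dvd 2 * x \<longleftrightarrow> 3 dvd x" "3 dvd 2 * y \<longleftrightarrow> 3 dvd y" by presburger+
    then show ?case by (simp add: p dvd3_diff_def)
  qed
  have odd: "(\<Sum>p \<in> {p \<in> S. odd (fst p)}. dvd3_diff p)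
    = (\<Sum>(u, v) \<in> {(u, v) \<in> norm7 (8 * n). odd u \<and> 8 dvd v - 5 * u}. kron3 u * kron3 v)"
  \<comment> \<open>Multiplication of x + y sqrt(-7) by \<omega>, of norm 2. Here
    \<open>v - u = 4 * y\<close>, and \<open>x\<close> odd forces \<open>v\<close> to be 5u modulo
    8.\<close>
  proof (rule sum.reindex_bij_witness[of _ "\<lambda>(u, v). (2 * v - (v - u) div 4, (v - u) div 4)"
        "\<lambda>(x, y). ((x - 7 * y) div 2, (x + y) div 2)"], goal_cases)
    case (1 p)
    then obtain x y b where p: "p = (x, y)" "y - x = 4 * b"
      by (auto simp: S_def norm7_def elim!: dvdE)
    then have x: "x = y - 4 * b" by simp
    have e: "(x - 7 * y) div 2 = - 3 * y - 2 * b" "(x + y) div 2 = y - 2 * b" unfolding x by simp_all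
    show ?case unfolding p(1) prod.case e by (simp add: x)
  next
    case (2 p)
    then obtain x y b where p: "p = (x, y)" "x\<^sup>2 + 7 * y\<^sup>2 = 4 * n" "odd x" "y - x = 4 * b"
      by (auto simp: S_def norm7_def elim!: dvdE)
    then have x: "x = y - 4 * b" by simp
    have e: "(x - 7 * y) div 2 = - 3 * y - 2 * b" "(x + y) div 2 = y - 2 * b" unfolding x by simp_all
    have "odd (- 3 * y - 2 * b)" "8 dvd (y - 2 * b) - 5 * (- 3 * y - 2 * b)" 
      using p(3) unfolding x by presburger+
    then show ?case using p(2) unfolding p(1) prod.case e unfolding norm7_def x
      by (auto simp: power2_eq_square algebra_simps)
  next
    case (3 p)
    then have "4 dvd snd p - fst p" "odd (fst p)" by (auto elim!: dvdE) presburger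
    then show ?case by (cases p) (auto elim!: dvdE)
  next
    case (4 p)
    then obtain u v where p: "p = (u, v)" "u\<^sup>2 + 7 * v\<^sup>2 = 8 * n" "odd u" "8 dvd v - 5 * u"
      by (auto simp: norm7_def)
    then have "4 dvd v - u" by presburger
    then obtain k where k: "v - u = 4 * k" by blast
    then have u: "u = v - 4 * k" by simp
    have "odd (2 * v - k)" using p(3,4) unfolding u by presburger
    moreover have "4 dvd k - (2 * v - k)" using p(3,4) unfolding u by presburger
    ultimately show ?case using p(2) unfolding p(1) S_def norm7_def u
      by (auto simp: power2_eq_square algebra_simps)
  next
    case (5 p)
    then obtain x y b where p: "p = (x, y)" "y - x = 4 * b"
      by (auto simp: S_def norm7_def elim!: dvdE)
    then have x: "x = y - 4 * b" by simp
    have e: "(x - 7 * y) div 2 = - 3 * y - 2 * b" "(x + y) div 2 = y - 2 * b" unfolding x by simp_all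
    \<comment> \<open>Halving is negation modulo 3; the two sign changes cancel in the
      product.\<close>
    have "kron3 (- 3 * y - 2 * b) = kron3 (- (x - y))" "kron3 (y - 2 * b) = kron3 (- (x + y))"
      unfolding x by (rule kron3_mod; presburger)+
    then show ?case unfolding p(1) prod.case e dvd3_diff_eq_kron3 kron3_minus by simp
  qed
  have "(\<Sum>p \<in> {p \<in> S. even (fst p)}. dvd3_diff p) + (\<Sum>p \<in> {p \<in> S. odd (fst p)}. dvd3_diff p)
      = (\<Sum>p \<in> {p \<in> S. even (fst p)} \<union> {p \<in> S. odd (fst p)}. dvd3_diff p)"
    by (rule sum.union_disjoint[symmetric]) (use fin in auto)
  also have "{p \<in> S. even (fst p)} \<union> {p \<in> S. odd (fst p)} = S" by auto
  finally show ?thesis using sum_dvd3_diff_cong4[of n] unfolding even odd[symmetric] S_def by linarith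
qed

text \<open>The Kronecker symbol \<open>(-2/u)\<close>, but only for odd \<open>u\<close>: at even \<open>u\<close> the value here is \<open>-1\<close>.\<close>

definition kron8 :: "int \<Rightarrow> int" where
  "kron8 u = (if u mod 8 = 1 \<or> u mod 8 = 3 then 1 else -1)"

text \<open>Both congruences modulo 8 force \<open>u\<close> and \<open>v\<close> odd, and
  \<open>kron3\<close> removes multiples of 3. Each remaining pair arises by sign flips from a
  unique pair with both entries 1 mod 6.\<close>

lemma sum_dvd3_diff_eq_kron8:
  "(\<Sum>(x, y) \<in> norm7 n. dvd3_diff (x, y))
   = 2 * (\<Sum>(u, v) \<in> {(u, v) \<in> norm7 (8 * n). u mod 6 = 1 \<and> v mod 6 = 1}. kron8 u * kron8 v)"
proof -
  define R where "R = {(u, v) \<in> norm7 (8 * n). odd u \<and> odd v}"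
  define t where "t = (\<lambda>(u, v). kron3 u * kron3 v * (of_bool (8 dvd v - u) - of_bool (8 dvd v - 5 * u)))"
  define D where "D a b = {(u, v) \<in> R. u mod 3 = a \<and> v mod 3 = b}" for a b
  have finR: "finite R" unfolding R_def using finite_norm7 by (rule finite_subset[rotated]) auto
  have finD: "finite (D a b)" for a b unfolding D_def using finR by (rule finite_subset[rotated]) auto
  have "(\<Sum>(x, y) \<in> norm7 n. dvd3_diff (x, y))
      = (\<Sum>(x, y) \<in> {(x, y) \<in> norm7 n. odd (x + y)} \<union> {(x, y) \<in> norm7 n. even (x + y)}. dvd3_diff (x, y))"
    by (rule sum.cong) auto
  also have "\<dots> = (\<Sum>(x, y) \<in> {(x, y) \<in> norm7 n. odd (x + y)}. dvd3_diff (x, y))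
      + (\<Sum>(x, y) \<in> {(x, y) \<in> norm7 n. even (x + y)}. dvd3_diff (x, y))"
    by (rule sum.union_disjoint) (auto intro: finite_subset[OF _ finite_norm7[of n]])
  also have "\<dots> = (\<Sum>(u, v) \<in> {(u, v) \<in> norm7 (8 * n). odd u \<and> 8 dvd v - u}. kron3 u * kron3 v)
     - (\<Sum>(u, v) \<in> {(u, v) \<in> norm7 (8 * n). odd u \<and> 8 dvd v - 5 * u}. kron3 u * kron3 v)"
    unfolding sum_dvd3_diff_odd sum_dvd3_diff_even by simp
  also have "(\<Sum>(u, v) \<in> {(u, v) \<in> norm7 (8 * n). odd u \<and> 8 dvd v - u}. kron3 u * kron3 v)
      = (\<Sum>(u, v) \<in> R. kron3 u * kron3 v * of_bool (8 dvd v - u))"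
  proof (rule sum.mono_neutral_cong_left[OF finR])
    show "{(u, v) \<in> norm7 (8 * n). odd u \<and> 8 dvd v - u} \<subseteq> R"
      unfolding R_def by clarify presburger
  qed (auto simp: R_def)
  also have "(\<Sum>(u, v) \<in> {(u, v) \<in> norm7 (8 * n). odd u \<and> 8 dvd v - 5 * u}. kron3 u * kron3 v)
      = (\<Sum>(u, v) \<in> R. kron3 u * kron3 v * of_bool (8 dvd v - 5 * u))"
  proof (rule sum.mono_neutral_cong_left[OF finR])
    show "{(u, v) \<in> norm7 (8 * n). odd u \<and> 8 dvd v - 5 * u} \<subseteq> R"
      unfolding R_def by clarify presburger
  qed (auto simp: R_def)
  also have "(\<Sum>(u, v) \<in> R. kron3 u * kron3 v * of_bool (8 dvd v - u))
      - (\<Sum>(u, v) \<in> R. kron3 u * kron3 v * of_bool (8 dvd v - 5 * u)) = sum t R"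
    unfolding t_def by (simp add: sum_subtractf case_prod_unfold right_diff_distrib)
  also have "sum t R = sum t (D 1 1 \<union> D 2 1 \<union> D 1 2 \<union> D 2 2)"
  proof (rule sum.mono_neutral_right[OF finR])
    show "\<forall>p\<in>R - (D 1 1 \<union> D 2 1 \<union> D 1 2 \<union> D 2 2). t p = 0"
    proof
      fix p assume p: "p \<in> R - (D 1 1 \<union> D 2 1 \<union> D 1 2 \<union> D 2 2)"
      obtain u v where uv: "p = (u, v)" by (cases p)
      have "u mod 3 \<in> {0, 1, 2}" "v mod 3 \<in> {0, 1, 2}" by auto
      then have "u mod 3 = 0 \<or> v mod 3 = 0" using p by (auto simp: D_def uv)
      then show "t p = 0" by (auto simp: t_def uv kron3_def)
    qed
  qed (auto simp: D_def)
  also have "\<dots> = sum t (D 1 1) + sum t (D 2 1) + sum t (D 1 2) + sum t (D 2 2)"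
    by (subst sum.union_disjoint, simp_all add: finD, (auto simp: D_def)[1])+
  also have "sum t (D 2 1) = (\<Sum>(u, v) \<in> D 1 1. t (- u, v))"
    by (rule sum.reindex_bij_witness[of _ "\<lambda>(u, v). (- u, v)" "\<lambda>(u, v). (- u, v)"])
       (auto simp: D_def R_def norm7_def, presburger+)
  also have "sum t (D 1 2) = (\<Sum>(u, v) \<in> D 1 1. t (u, - v))"
    by (rule sum.reindex_bij_witness[of _ "\<lambda>(u, v). (u, - v)" "\<lambda>(u, v). (u, - v)"])
       (auto simp: D_def R_def norm7_def, presburger+)
  also have "sum t (D 2 2) = (\<Sum>(u, v) \<in> D 1 1. t (- u, - v))"
    by (rule sum.reindex_bij_witness[of _ "\<lambda>(u, v). (- u, - v)" "\<lambda>(u, v). (- u, - v)"])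
       (auto simp: D_def R_def norm7_def, presburger+)
  also have "sum t (D 1 1) + (\<Sum>(u, v) \<in> D 1 1. t (- u, v)) + (\<Sum>(u, v) \<in> D 1 1. t (u, - v))
      + (\<Sum>(u, v) \<in> D 1 1. t (- u, - v)) 
      = (\<Sum>(u, v) \<in> D 1 1. t (u, v) + t (- u, v) + t (u, - v) + t (- u, - v))"
    by (simp add: sum.distrib case_prod_unfold)
  \<comment> \<open>Let r = v/u mod 8. Equal signs contribute 2([r=1] - [r=5]) and opposite signs
    2([r=3] - [r=7]), as \<open>kron3\<close> is odd; the total is 2(-2/r).\<close>
  also have "\<dots> = (\<Sum>(u, v) \<in> D 1 1. 2 * (kron8 u * kron8 v))"
  proof (rule sum.cong[OF refl], clarify)
    fix u v assume "(u, v) \<in> D 1 1"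
    then have uv: "odd u" "odd v" "u mod 3 = 1" "v mod 3 = 1" by (auto simp: D_def R_def)
    have k: "kron3 u = 1" "kron3 v = 1" using uv by (auto simp: kron3_def)
    have t_mod: "t (a, b) = kron3 a * kron3 b
        * (of_bool (b mod 8 = a mod 8) - of_bool (b mod 8 = 5 * (a mod 8) mod 8))" for a b
      by (simp add: t_def mod_eq_dvd_iff mod_mult_right_eq)
    have "u mod 8 = 1 \<or> u mod 8 = 3 \<or> u mod 8 = 5 \<or> u mod 8 = 7" using uv(1) by presburger
    moreover have "v mod 8 = 1 \<or> v mod 8 = 3 \<or> v mod 8 = 5 \<or> v mod 8 = 7" using uv(2) by presburger
    ultimately show "t (u, v) + t (- u, v) + t (u, - v) + t (- u, - v) = 2 * (kron8 u * kron8 v)"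
      unfolding t_mod mod_minus_eq[of u 8, symmetric] mod_minus_eq[of v 8, symmetric]
        kron3_minus k kron8_def
      by (elim disjE; simp only:; simp)
  qed
  also have "D 1 1 = {(u, v) \<in> norm7 (8 * n). u mod 6 = 1 \<and> v mod 6 = 1}"
  proof -
    have "odd u \<and> u mod 3 = 1 \<longleftrightarrow> u mod 6 = 1" for u :: int by presburger
    then show ?thesis unfolding D_def R_def by blast
  qed
  finally show ?thesis by (simp add: sum_distrib_left case_prod_unfold)
qed

section \<open>Coefficients of the theta series and of the Euler products\<close>

lemma qf_theta_nth:
  fixes a b c :: int
  assumes "a > 0" "b\<^sup>2 < 4 * a * c"
  shows "fps_nth (qf_theta a b c fps_X :: 'a::comm_ring_1 fps) n
       = of_nat (card {(x, y). a * x\<^sup>2 + b * x * y + c * y\<^sup>2 = int n})"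
proof -
  define Q where "Q = (\<lambda>(x::int, y::int). a * x\<^sup>2 + b * x * y + c * y\<^sup>2)"
  \<comment> \<open>Nonnegativity makes \<open>nat (Q p) = n\<close> equivalent to
    \<open>Q p = int n\<close>; negative values would all be counted at
    \<open>n = 0\<close>.\<close>
  have nonneg: "Q p \<ge> 0" for p
  proof -
    obtain x y where p: "p = (x, y)" by (cases p)
    have "4 * a * Q p = (2 * a * x + b * y)\<^sup>2 + (4 * a * c - b\<^sup>2) * y\<^sup>2"
      by (simp add: Q_def p power2_eq_square algebra_simps)
    moreover have "(4 * a * c - b\<^sup>2) * y\<^sup>2 \<ge> 0" using assms(2) by simp
    ultimately have "4 * a * Q p \<ge> 0" by simp
    then show ?thesis using assms(1) by (simp add: zero_le_mult_iff)
  qed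
  have "((\<lambda>p. (fps_X :: 'a fps) ^ nat (Q p)) has_sum qf_theta a b c fps_X) UNIV"
    using has_sum_infsum[OF qf_theta_summable[OF assms]]
    by (simp add: qf_theta_def Q_def case_prod_unfold)
  then have "fps_nth (qf_theta a b c fps_X :: 'a fps) n
      = (\<Sum>p | p \<in> UNIV \<and> fps_nth ((fps_X :: 'a fps) ^ nat (Q p)) n \<noteq> 0. fps_nth (fps_X ^ nat (Q p)) n)"
    by (rule has_sum_fpsD(2))
  also have "{p \<in> UNIV. fps_nth ((fps_X :: 'a fps) ^ nat (Q p)) n \<noteq> 0} = {p. Q p = int n}"
    using nonneg by (auto simp: fps_X_power_nth split: if_splits)
  also have "(\<Sum>p\<in>{p. Q p = int n}. fps_nth ((fps_X :: 'a fps) ^ nat (Q p)) n)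
      = of_nat (card {p. Q p = int n})"
    by (simp add: fps_X_power_nth)
  finally show ?thesis by (simp add: Q_def case_prod_unfold)
qed

text \<open>At argument \<open>- (fps_X ^ k)\<close> the pentagonal sign combines with that of the
  argument. The parity of the exponent and \<open>6 * j + 1\<close> mod 8 both depend only on
  \<open>j mod 4\<close>.\<close>

lemma sign_pent_eq_kron8: "(-1) ^ (nat \<bar>j\<bar> + pent j) = kron8 (6 * j + 1)"
proof -
  define k r where "k = j div 4" and "r = j mod 4"
  have j: "j = 4 * k + r" by (simp add: k_def r_def)
  have r: "r \<in> {0, 1, 2, 3}" unfolding r_def by auto
  \<comment> \<open>Chosen so that \<open>4 * w\<close> is the part of
    \<open>j * (3 * j + 1)\<close> beyond \<open>r * (3 * r + 1)\<close>.\<close>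
  define w where "w = 12 * k\<^sup>2 + 6 * k * r + k"
  have w: "2 * int (pent j) = 4 * w + r * (3 * r + 1)"
    unfolding int_pent j w_def by (simp add: power2_eq_square algebra_simps)
  have "even (nat \<bar>j\<bar> + pent j) \<longleftrightarrow> even (j + int (pent j))"
    by (simp add: even_nat_iff)
  also have "\<dots> \<longleftrightarrow> r = 0 \<or> r = 3"
    using r
  proof (elim insertE emptyE)
    assume r: "r = 0"
    then have "int (pent j) = 2 * w" using w by simp
    then show ?thesis using r by (simp add: j)
  next
    assume r: "r = 1"
    then have "int (pent j) = 2 * w + 2" using w by simp
    then show ?thesis using r by (simp add: j)
  next
    assume r: "r = 2"
    then have "int (pent j) = 2 * w + 7" using w by simp
    then show ?thesis using r by (simp add: j)
  next
    assume r: "r = 3"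
    then have "int (pent j) = 2 * w + 15" using w by simp
    then show ?thesis using r by (simp add: j)
  qed
  finally have parity: "even (nat \<bar>j\<bar> + pent j) \<longleftrightarrow> r = 0 \<or> r = 3" .
  have "6 * j + 1 = (6 * r + 1) + 8 * (3 * k)" by (simp add: j)
  then have mod: "(6 * j + 1) mod 8 = (6 * r + 1) mod 8" by (simp only: mod_mult_self2)
  show ?thesis unfolding minus_one_power_iff parity kron8_def mod using r by auto
qed

lemma euler_E_mult_nth:
  fixes k l :: nat
  assumes "k > 0" "l > 0"
  shows "fps_nth (euler_E (- (fps_X ^ k)) * euler_E (- (fps_X ^ l)) :: 'a::idom fps) n
       = of_int (\<Sum>(i, j) \<in> {(i, j). k * pent i + l * pent j = n}. kron8 (6 * i + 1) * kron8 (6 * j + 1))"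
proof -
  \<comment> \<open>One window for both factors: it is valid for all coefficients up to
    \<open>n\<close>, and by \<open>abs_le_pent\<close> it contains every index pair of total
    exponent \<open>n\<close>.\<close>
  define B where "B = {- int n..int n}"
  define S :: "nat \<Rightarrow> 'a fps"
    where "S k = (\<Sum>j\<in>B. fps_const (of_int (kron8 (6 * j + 1))) * fps_X ^ (k * pent j))" for k
  have S: "fps_nth (euler_E (- (fps_X ^ k)) :: 'a fps) i = fps_nth (S k) i" if "k > 0" "i \<le> n" for k i
  proof -
    have summand: "(-1) ^ nat \<bar>j\<bar> * (- (fps_X ^ k)) ^ pent j
        = fps_const (of_int (kron8 (6 * j + 1))) * (fps_X :: 'a fps) ^ (k * pent j)" for j
    proof -
      have "fps_const (of_int (kron8 (6 * j + 1)) :: 'a) = (-1) ^ (nat \<bar>j\<bar> + pent j)"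
        unfolding sign_pent_eq_kron8[symmetric] by (simp add: fps_const_power[symmetric] fps_const_neg[symmetric] del: fps_const_neg fps_const_power)
      then show ?thesis by (simp add: power_add power_mult power_minus[of "fps_X ^ k"])
    qed
    have "fps_nth (euler_E (- (fps_X ^ k)) :: 'a fps) i
        = fps_nth (\<Sum>j\<in>B. (-1) ^ nat \<bar>j\<bar> * (- (fps_X ^ k)) ^ pent j) i"
      unfolding B_def by (rule euler_E_nth) (use that in simp_all)
    also have "(\<Sum>j\<in>B. (-1) ^ nat \<bar>j\<bar> * (- (fps_X ^ k)) ^ pent j) = S k"
      unfolding S_def by (intro sum.cong refl summand)
    finally show ?thesis .
  qed
  have "fps_nth (euler_E (- (fps_X ^ k)) * euler_E (- (fps_X ^ l)) :: 'a fps) n = fps_nth (S k * S l) n"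
    unfolding fps_mult_nth by (rule sum.cong) (auto simp: S assms)
  also have "S k * S l = (\<Sum>(i, j)\<in>B \<times> B.
      fps_const (of_int (kron8 (6 * i + 1) * kron8 (6 * j + 1))) * fps_X ^ (k * pent i + l * pent j))"
    unfolding S_def sum_product sum.cartesian_product
    by (rule sum.cong) (auto simp: power_add mult_ac fps_const_mult[symmetric] simp del: fps_const_mult)
  also have "fps_nth \<dots> n = (\<Sum>(i, j)\<in>B \<times> B.
      if n = k * pent i + l * pent j then of_int (kron8 (6 * i + 1) * kron8 (6 * j + 1)) else 0)"
    unfolding fps_sum_nth by (rule sum.cong) (auto simp: fps_X_power_nth)
  also have "\<dots> = (\<Sum>(i, j) \<in> {(i, j). k * pent i + l * pent j = n}.
      of_int (kron8 (6 * i + 1) * kron8 (6 * j + 1)))"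
  proof (rule sum.mono_neutral_cong_right)
    show "{(i, j). k * pent i + l * pent j = n} \<subseteq> B \<times> B"
    proof clarify
      fix i j assume n: "n = k * pent i + l * pent j"
      have "pent i \<le> k * pent i" "pent j \<le> l * pent j" using assms by simp_all
      then have "int (pent i) \<le> int n" "int (pent j) \<le> int n" unfolding n by linarith+
      then show "i \<in> B \<and> j \<in> B" using abs_le_pent[of i] abs_le_pent[of j] by (auto simp: B_def)
    qed
  qed (auto simp: B_def split: if_splits)
  finally show ?thesis by (simp add: case_prod_unfold)
qed

section \<open>Comparison of coefficients\<close>

lemma sum_dvd3_diff_eq_card:
  "(\<Sum>(x, y) \<in> norm7 n. dvd3_diff (x, y))
   = int (card {(x, y). 1 * x\<^sup>2 + 0 * x * y + 63 * y\<^sup>2 = n})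
     - int (card {(x, y). 7 * x\<^sup>2 + 0 * x * y + 9 * y\<^sup>2 = n})"
proof -
  \<comment> \<open>A factor 3 of \<open>y\<close> turns \<open>7 * y^2\<close> into
    \<open>63 * y^2\<close>; a factor 3 of \<open>x\<close> turns \<open>x^2\<close> into 9 times a
    square, with the roles of the variables exchanged.\<close>
  have "card {(x, y). 1 * x\<^sup>2 + 0 * x * y + 63 * y\<^sup>2 = n} = card {(x, y) \<in> norm7 n. 3 dvd y}"
    by (rule bij_betw_same_card[OF bij_betwI[of "\<lambda>(x, y). (x, 3 * y)" _ _ "\<lambda>(x, y). (x, y div 3)"]])
       (auto simp: norm7_def power2_eq_square elim!: dvdE)
  moreover have "card {(x, y). 7 * x\<^sup>2 + 0 * x * y + 9 * y\<^sup>2 = n} = card {(x, y) \<in> norm7 n. 3 dvd x}"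
    by (rule bij_betw_same_card[OF bij_betwI[of "\<lambda>(x, y). (3 * y, x)" _ _ "\<lambda>(x, y). (y, x div 3)"]])
       (auto simp: norm7_def power2_eq_square elim!: dvdE)
  moreover have count: "(\<Sum>p \<in> norm7 n. of_bool (P p)) = int (card {p \<in> norm7 n. P p})" for P
    using finite_norm7[of n]
    by (simp add: of_bool_def sum.If_cases Collect_conj_eq Int_commute)
  have "(\<Sum>(x, y) \<in> norm7 n. dvd3_diff (x, y))
      = int (card {p \<in> norm7 n. 3 dvd snd p}) - int (card {p \<in> norm7 n. 3 dvd fst p})"
    unfolding count[symmetric] dvd3_diff_def by (simp add: case_prod_unfold sum_subtractf)
  ultimately show ?thesis by (simp add: case_prod_unfold)
qed

text \<open>By \<open>pent_square\<close>,
  \<open>u^2 + 7 * v^2 = 8 * (1 + 3 * pent i + 21 * pent j)\<close>; the summand 1 is the exponent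
  of the factor \<open>fps_X\<close>.\<close>

lemma sum_kron8_eq_pent:
  "(\<Sum>(u, v) \<in> {(u, v) \<in> norm7 (8 * int n). u mod 6 = 1 \<and> v mod 6 = 1}. kron8 u * kron8 v)
   = (\<Sum>(i, j) \<in> {(i, j). 1 + (3 * pent i + 21 * pent j) = n}. kron8 (6 * i + 1) * kron8 (6 * j + 1))"
proof -
  have norm: "(6 * i + 1, 6 * j + 1) \<in> norm7 (8 * int n) \<longleftrightarrow> 1 + (3 * pent i + 21 * pent j) = n" for i j
    unfolding norm7_def prod.case mem_Collect_eq pent_square[symmetric] by auto
  have ex: "\<exists>i. u = 6 * i + 1" if "u mod 6 = 1" for u :: int using that by presburger
  have inv: "(6 * i + 1) div 6 = i" "(6 * i + 1) mod 6 = 1" for i :: int by presburger+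
  show ?thesis unfolding norm[symmetric]
    by (rule sum.reindex_bij_witness[of _ "\<lambda>(i, j). (6 * i + 1, 6 * j + 1)" "\<lambda>(u, v). (u div 6, v div 6)"])
       (auto simp: inv dest!: ex)
qed

theorem theorem5p3:
  shows "(qf_theta 1 0 63 fps_X - qf_theta 7 0 9 fps_X) / 2
       = (fps_X :: rat fps) * euler_E (- (fps_X ^ 3)) * euler_E (- (fps_X ^ 21))"
proof -
  define R :: "rat fps" where "R = fps_X * euler_E (- (fps_X ^ 3)) * euler_E (- (fps_X ^ 21))"
  have "fps_nth (qf_theta 1 0 63 fps_X - qf_theta 7 0 9 fps_X) n = fps_nth (2 * R) n" for n
  proof -
    define T where "T = (\<Sum>(i, j) \<in> {(i, j). 1 + (3 * pent i + 21 * pent j) = n}.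
        kron8 (6 * i + 1) * kron8 (6 * j + 1))"
    have "fps_nth (qf_theta 1 0 63 fps_X - qf_theta 7 0 9 fps_X :: rat fps) n
        = of_int (\<Sum>(x, y) \<in> norm7 (int n). dvd3_diff (x, y))"
      unfolding sum_dvd3_diff_eq_card fps_sub_nth
      by (subst (1 2) qf_theta_nth) simp_all
    also have "\<dots> = 2 * of_int T"
      unfolding sum_dvd3_diff_eq_kron8 sum_kron8_eq_pent T_def by simp
    also have "of_int T = fps_nth R n"
    proof (cases n)
      \<comment> \<open>The factor \<open>fps_X\<close> kills this coefficient, and the index set of
        \<open>T\<close> is empty.\<close>
      case 0
      then show ?thesis by (simp add: R_def T_def mult.assoc)
    next
      case (Suc m)
      then show ?thesis
        using euler_E_mult_nth[of 3 21 m, where 'a = rat] by (simp add: R_def T_def mult.assoc)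
    qed
    finally show ?thesis by (simp only: mult_2 fps_add_nth)
  qed
  then have "qf_theta 1 0 63 fps_X - qf_theta 7 0 9 fps_X = 2 * R" by (rule fps_ext)
  then have "(qf_theta 1 0 63 fps_X - qf_theta 7 0 9 fps_X) / 2 = R"
    by (simp only: nonzero_mult_div_cancel_left[OF zero_neq_numeral[symmetric]])
  then show ?thesis unfolding R_def .
qed

end
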